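(* Consider an MTDC system controlled by the droop controller $u_i=-K_i^P(V_i-V_i^{\text{nom}})$, $i\in\mathcal{V}$, with fixed gains $K_i^P>0$. Then for any finite bounds $\underline{V}_i,\overline{V}_i\in\mathbb{R}$, $i\in\mathcal{V}$, the voltage-range objective is in general not satisfied; that is, there exist a constant disturbance $I^{\text{inj}}\in\mathbb{R}^n$ and a solution $V(t)$ of the closed-loop system for which it is not the case that $\lim_{t\to\infty}V_i(t)$ exists and lies in $[\underline{V}_i,\overline{V}_i]$ for every $i\in\mathcal{V}$.
   Context: MTDC system: let $\mathcal{G}$ be a fixed, undirected, connected graph with vertex set $\mathcal{V}=\{1,\dots,n\}$ (terminals) and edge set $\mathcal{E}$ (lines); the neighbours of $i$ are $\mathcal{N}_i$. Each edge $(i,j)$ has resistance $R_{ij}=R_{ji}>0$ and each terminal has capacitance $C_i>0$. The voltages obey $C_i\dot V_i=-\sum_{j\in\mathcal{N}_i}\frac{1}{R_{ij}}(V_i-V_j)+I_i^{\text{inj}}+u_i$ for $i\in\mathcal{V}$, where $I_i^{\text{inj}}$ is a constant uncontrolled injected current (disturbance) and $u_i$ is the controlled injected current. The nominal voltages are equal: $V_i^{\text{nom}}=V_j^{\text{nom}}$ for all $i,j\in\mathcal{V}$. Voltage-range objective: under any constant disturbance $I^{\text{inj}}\in\mathbb{R}^n$, $\lim_{t\to\infty}V_i(t)\in[\underline{V}_i,\overline{V}_i]$ for all $i\in\mathcal{V}$. *)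

theory Defs
  imports "HOL-Analysis.Analysis" "Graph_Theory.Graph_Theory"
begin

text \<open>
  An undirected simple graph is a \<open>pair_graph\<close>: a finite loop-free digraph with symmetric
  arc relation, in which the line between \<open>i\<close> and \<open>j\<close> is represented by both arcs
  \<open>(i, j)\<close> and \<open>(j, i)\<close>. Its vertex set is all of the finite type \<open>'n\<close>, so that terminal
  quantities (voltages, capacitances, gains, currents) are vectors in \<open>real ^ 'n\<close>.
\<close>

definition neighbours :: "'n pair_pre_digraph \<Rightarrow> 'n \<Rightarrow> 'n set" where
  "neighbours G i = {j. (i, j) \<in> parcs G}"

locale mtdc_system = pair_graph G
  for G :: "'n::finite pair_pre_digraph" +
  fixes R :: "'n \<Rightarrow> 'n \<Rightarrow> real"
    and C :: "real ^ 'n"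
    and Vnom :: "real ^ 'n"
  assumes verts_UNIV: "pverts G = UNIV"
    and connected_graph: "Digraph_Component.connected (with_proj G)"
    and resistance_sym: "(i, j) \<in> parcs G \<Longrightarrow> R i j = R j i"
    and resistance_pos: "(i, j) \<in> parcs G \<Longrightarrow> R i j > 0"
    and capacitance_pos: "C $ i > 0"
    and nominal_equal: "Vnom $ i = Vnom $ j"

text \<open>
  \<open>V\<close> solves the voltage dynamics on \<open>[0, \<infinity>)\<close> with constant disturbance \<open>Iinj\<close> and controlled
  injected current \<open>u\<close>; the derivative at time 0 is one-sided.
\<close>

definition mtdc_solution ::
  "'n::finite pair_pre_digraph \<Rightarrow> ('n \<Rightarrow> 'n \<Rightarrow> real) \<Rightarrow> real ^ 'n \<Rightarrow> real ^ 'n \<Rightarrow>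
    (real \<Rightarrow> real ^ 'n) \<Rightarrow> (real \<Rightarrow> real ^ 'n) \<Rightarrow> bool" where
  "mtdc_solution G R C Iinj u V \<longleftrightarrow>
    (\<forall>t\<ge>0. \<forall>i. \<exists>D.
      ((\<lambda>s. V s $ i) has_real_derivative D) (at t within {0..}) \<and>
      C $ i * D =
        - (\<Sum>j\<in>neighbours G i. 1 / R i j * (V t $ i - V t $ j)) + Iinj $ i + u t $ i)"

definition droop_control :: "real ^ 'n \<Rightarrow> real ^ 'n \<Rightarrow> real ^ 'n \<Rightarrow> real ^ 'n" where
  "droop_control KP Vnom v = (\<chi> i. - KP $ i * (v $ i - Vnom $ i))"

definition limit_voltages_in_range ::
  "real ^ 'n \<Rightarrow> real ^ 'n \<Rightarrow> (real \<Rightarrow> real ^ 'n) \<Rightarrow> bool" where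
  "limit_voltages_in_range Vlo Vhi V \<longleftrightarrow>
    (\<forall>i. \<exists>L. ((\<lambda>t. V t $ i) \<longlongrightarrow> L) at_top \<and> L \<in> {Vlo $ i..Vhi $ i})"

end

theory Submission
  imports Defs
begin

text \<open>
  The droop law is a static state feedback: at a given voltage vector \<open>v\<close> it injects a fixed
  current. The disturbance enters every terminal's current balance additively and is
  unrestricted, so it can be chosen to balance both the line currents and the droop current
  at \<open>v\<close>. Hence every voltage vector is an equilibrium of the closed loop under a suitable
  constant disturbance (\<open>every_voltage_is_an_equilibrium\<close>), and resting at an equilibrium
  above the upper bounds violates the voltage-range objective.
\<close>

text \<open>
  The disturbance solves the current balance with zero capacitor current. This works for any
  static feedback \<open>u\<close>, since only the value of the control law at \<open>v\<close> enters.
\<close>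

lemma every_voltage_is_an_equilibrium:
  fixes u :: "real ^ 'n \<Rightarrow> real ^ 'n::finite" and v :: "real ^ 'n"
  obtains Iinj where "mtdc_solution G R C Iinj (\<lambda>t. u v) (\<lambda>t. v)"
proof
  let ?I = "\<chi> i. (\<Sum>j\<in>neighbours G i. 1 / R i j * (v $ i - v $ j)) - u v $ i"
  show "mtdc_solution G R C ?I (\<lambda>t. u v) (\<lambda>t. v)"
    unfolding mtdc_solution_def by (intro allI impI exI[of _ 0]) simp
qed

lemma const_above_range_not_limit_voltages_in_range:
  assumes "Vhi $ k < v $ k"
  shows "\<not> limit_voltages_in_range Vlo Vhi (\<lambda>t. v)"
proof
  assume "limit_voltages_in_range Vlo Vhi (\<lambda>t. v)"
  then obtain L where lim: "((\<lambda>t::real. v $ k) \<longlongrightarrow> L) at_top" and "L \<le> Vhi $ k"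
    unfolding limit_voltages_in_range_def by fastforce
  moreover have "L = v $ k"
    using tendsto_unique[OF _ lim tendsto_const] by simp
  ultimately show False using assms by simp
qed

theorem lemma2:
  fixes G :: "'n::finite pair_pre_digraph"
    and R :: "'n \<Rightarrow> 'n \<Rightarrow> real"
    and C Vnom KP Vlo Vhi :: "real ^ 'n"
  assumes "mtdc_system G R C Vnom"
    and "\<And>i. KP $ i > 0"
  shows "\<exists>(Iinj :: real ^ 'n) (V :: real \<Rightarrow> real ^ 'n).
           mtdc_solution G R C Iinj (\<lambda>t. droop_control KP Vnom (V t)) V \<and>
           \<not> limit_voltages_in_range Vlo Vhi V"
proof -
  define v where "v = (\<chi> i. Vhi $ i + 1)"
  obtain Iinj where "mtdc_solution G R C Iinj (\<lambda>t. droop_control KP Vnom v) (\<lambda>t. v)"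
    by (rule every_voltage_is_an_equilibrium)
  moreover have "\<not> limit_voltages_in_range Vlo Vhi (\<lambda>t. v)"
    by (rule const_above_range_not_limit_voltages_in_range) (simp add: v_def)
  ultimately show ?thesis
    by (intro exI[of _ Iinj] exI[of _ "\<lambda>t. v"] conjI)
qed

end
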